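(* Let $r\ge 2$ and $m\geq (4r+2)^2+1$ be integers, and let $G\in \mathcal{G}(m,K_{2,r+1})\setminus\{S_{m+1}\}$, i.e. $G$ is a $K_{2,r+1}$-free graph with exactly $m$ edges and no isolated vertices, and $G$ is not isomorphic to the star $S_{m+1}$ on $m+1$ vertices. Then $\rho(G)\leq \rho(S_m^1)$, where $\rho(S_m^1)$ is the largest real root of the equation $x^3-x^2-(m-1)x+m-3=0$, and equality $\rho(G)=\rho(S_m^1)$ holds if and only if $G\cong S_m^1$.
   Context: All graphs are finite and simple. $\rho(G)$ denotes the spectral radius of the adjacency matrix $A(G)$ of $G$. The size of a graph is its number of edges. A graph is $F$-free if it does not contain a (not necessarily induced) subgraph isomorphic to $F$. $\mathcal{G}(m,F)$ denotes the set of $F$-free graphs of size $m$ without isolated vertices (graphs considered up to isomorphism). $K_{2,r+1}$ is the complete bipartite graph with parts of sizes $2$ and $r+1$. $S_n=K_{1,n-1}$ is the star of order $n$ (number of vertices $n$). $S_n^k$ is the graph obtained from the star of order $n$ by adding $k$ pairwise disjoint edges within its independent set of leaves; thus $S_m^1$ is the star on $m$ vertices with one additional edge joining two leaves, and it has $m$ edges. *)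

theory Defs
  imports "Jordan_Normal_Form.Spectral_Radius"
begin

datatype 'a sgraph = SGraph (verts: "'a set") (edges: "'a set set")

definition simple_graph :: "'a sgraph \<Rightarrow> bool" where
  "simple_graph G \<longleftrightarrow> finite (verts G) \<and> (\<forall>e\<in>edges G. e \<subseteq> verts G \<and> card e = 2)"

definition graph_size :: "'a sgraph \<Rightarrow> nat" where
  "graph_size G = card (edges G)"

definition no_isolated_vertices :: "'a sgraph \<Rightarrow> bool" where
  "no_isolated_vertices G \<longleftrightarrow> (\<forall>v\<in>verts G. \<exists>e\<in>edges G. v \<in> e)"

definition graph_iso :: "'a sgraph \<Rightarrow> 'b sgraph \<Rightarrow> bool" where
  "graph_iso G H \<longleftrightarrow> (\<exists>f. bij_betw f (verts G) (verts H) \<and>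
     (\<forall>u\<in>verts G. \<forall>v\<in>verts G. {u, v} \<in> edges G \<longleftrightarrow> {f u, f v} \<in> edges H))"

definition subgraph :: "'a sgraph \<Rightarrow> 'a sgraph \<Rightarrow> bool" where
  "subgraph H G \<longleftrightarrow> simple_graph H \<and> verts H \<subseteq> verts G \<and> edges H \<subseteq> edges G"

definition graph_free :: "'a sgraph \<Rightarrow> 'b sgraph \<Rightarrow> bool" where
  "graph_free G F \<longleftrightarrow> \<not> (\<exists>H. subgraph H G \<and> graph_iso H F)"

text \<open>The class of graphs of size \<open>m\<close> that are \<open>F\<close>-free and have no isolated vertices.
  Its members are concrete graphs on vertices of type \<open>'a\<close>, not isomorphism classes; removing a
  graph from the class therefore means excluding all graphs isomorphic to it.\<close>

definition free_graphs :: "nat \<Rightarrow> 'b sgraph \<Rightarrow> 'a sgraph set" where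
  "free_graphs m F =
     {G. simple_graph G \<and> graph_size G = m \<and> no_isolated_vertices G \<and> graph_free G F}"

definition complete_bipartite :: "nat \<Rightarrow> nat \<Rightarrow> nat sgraph" where
  "complete_bipartite s t =
     SGraph {0..<s + t} {{i, j} | i j. i \<in> {0..<s} \<and> j \<in> {s..<s + t}}"

text \<open>The star on \<open>n \<ge> 1\<close> vertices: the centre is \<open>0\<close> and the leaves are \<open>1, \<dots>, n - 1\<close>.\<close>

definition star :: "nat \<Rightarrow> nat sgraph" where
  "star n = complete_bipartite 1 (n - 1)"

text \<open>The star on \<open>n\<close> vertices with the \<open>k\<close> disjoint edges \<open>{1, 2}, {3, 4}, \<dots>, {2k - 1, 2k}\<close>
  added between leaves; meaningful for \<open>2 * k + 1 \<le> n\<close>.\<close>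

definition star_plus :: "nat \<Rightarrow> nat \<Rightarrow> nat sgraph" where
  "star_plus n k =
     SGraph (verts (star n)) (edges (star n) \<union> {{2 * i + 1, 2 * i + 2} | i. i < k})"

text \<open>An arbitrary enumeration of the vertices. A different one conjugates the adjacency matrix by
  a permutation matrix, so the spectral radius does not depend on the choice.\<close>

definition vertex_list :: "'a sgraph \<Rightarrow> 'a list" where
  "vertex_list G = (SOME vs. distinct vs \<and> set vs = verts G)"

definition adjacency_matrix :: "'a sgraph \<Rightarrow> complex mat" where
  "adjacency_matrix G = (let vs = vertex_list G; n = length vs in
     mat n n (\<lambda>(i, j). if {vs ! i, vs ! j} \<in> edges G then 1 else 0))"

text \<open>The spectral radius of the empty graph is an unspecified value.\<close>

definition graph_spectral_radius :: "'a sgraph \<Rightarrow> real" where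
  "graph_spectral_radius G = spectral_radius (adjacency_matrix G)"

end

theory Submission
  imports Defs
begin

text \<open>
  The moduli of an eigenvector for an eigenvalue of maximal modulus form a vector \<open>y \<ge> 0\<close> with
  \<open>A y \<ge> \<rho> y\<close>; normalise it so that its maximum \<open>1\<close> is attained at \<open>u\<close>, and let \<open>c\<close> be the
  largest of the other entries, \<open>d\<close> the degree of \<open>u\<close>, \<open>a\<close> the number of edges avoiding \<open>u\<close>, and
  \<open>T\<close> the sum of the other entries. Two distinct vertices have at most \<open>r\<close> common neighbours, so
  counting walks of length two from \<open>u\<close> and from a vertex with entry \<open>c\<close> gives
  \<open>\<rho>\<^sup>2 \<le> d + r T\<close> and \<open>(\<rho>\<^sup>2 - a - 1) c \<le> r + r T\<close>, while handshaking gives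
  \<open>\<rho> T \<le> d + 2 a c\<close> and \<open>\<rho>\<^sup>2 \<le> d + 2 a c\<close>. If \<open>\<rho>\<^sup>2 > m - 1 = d + a - 1\<close> and
  \<open>\<rho> \<ge> 4 r + 2\<close>, these bounds successively force \<open>a < \<rho>\<^sup>2 / 3\<close>, \<open>c \<le> 1 / 3\<close>, \<open>a \<le> 2\<close> and, by
  \<open>\<rho> c \<le> 1 + a c\<close>, \<open>a \<le> 1\<close>. For \<open>a = 0\<close> the graph is the star. For \<open>a = 1\<close> either both ends
  of the extra edge are adjacent to \<open>u\<close>, or \<open>\<rho>\<^sup>2 \<le> m - 1 + c\<close> with \<open>(\<rho> - 1) c \<le> 1\<close>, which puts
  \<open>\<rho>\<close> below the largest root of the cubic \<open>(x - 1) (x\<^sup>2 - (m - 1)) - 2\<close>.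
\<close>

subsection \<open>Neighbourhoods\<close>

definition nbrs :: "'a sgraph \<Rightarrow> 'a \<Rightarrow> 'a set" where
  "nbrs G u = {v \<in> verts G. {u, v} \<in> edges G}"

lemma finite_nbrs: "simple_graph G \<Longrightarrow> finite (nbrs G u)"
  by (simp add: nbrs_def simple_graph_def)

lemma finite_edges: "simple_graph G \<Longrightarrow> finite (edges G)"
  by (rule finite_subset[of _ "Pow (verts G)"]) (auto simp: simple_graph_def)

lemma nbrs_sym: "\<lbrakk>u \<in> verts G; v \<in> nbrs G u\<rbrakk> \<Longrightarrow> u \<in> nbrs G v"
  by (auto simp: nbrs_def insert_commute)

lemma nbrs_irrefl: "simple_graph G \<Longrightarrow> u \<notin> nbrs G u"
  by (auto simp: nbrs_def simple_graph_def)

text \<open>Adjacency is symmetric, so the two ends of the ordered adjacent pairs may exchange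
  roles. For \<open>f u v = y v * z u\<close> this is the self-adjointness of the adjacency
  matrix.\<close>

lemma sum_nbrs_swap:
  fixes f :: "'a \<Rightarrow> 'a \<Rightarrow> 'b::comm_monoid_add"
  assumes "finite (verts G)"
  shows "(\<Sum>u\<in>verts G. \<Sum>v\<in>nbrs G u. f u v) = (\<Sum>v\<in>verts G. \<Sum>u\<in>nbrs G v. f u v)"
proof -
  have "(\<Sum>u\<in>verts G. \<Sum>v\<in>nbrs G u. f u v)
      = (\<Sum>v\<in>verts G. \<Sum>u | u \<in> verts G \<and> {u, v} \<in> edges G. f u v)"
    unfolding nbrs_def by (rule sum.swap_restrict) (use assms in auto)
  then show ?thesis by (simp add: nbrs_def insert_commute)
qed

subsection \<open>Eigenvalues as functions on vertices\<close>

lemma vertex_list: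
  assumes "finite (verts G)"
  shows "distinct (vertex_list G)" "set (vertex_list G) = verts G"
proof -
  have "\<exists>vs. distinct vs \<and> set vs = verts G"
    using finite_distinct_list[OF assms] by blast
  from someI_ex[OF this] show "distinct (vertex_list G)" "set (vertex_list G) = verts G"
    by (simp_all add: vertex_list_def)
qed

lemma length_vertex_list: "finite (verts G) \<Longrightarrow> length (vertex_list G) = card (verts G)"
  using distinct_card[OF vertex_list(1)] vertex_list(2) by fastforce

lemma adjacency_matrix_carrier:
  assumes "finite (verts G)"
  shows "adjacency_matrix G \<in> carrier_mat (card (verts G)) (card (verts G))"
  by (simp add: adjacency_matrix_def Let_def length_vertex_list[OF assms])

lemma bij_betw_vertex_list:
  assumes "finite (verts G)"
  shows "bij_betw ((!) (vertex_list G)) {..<card (verts G)} (verts G)"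
  by (rule bij_betw_nth) (simp_all add: vertex_list[OF assms] length_vertex_list[OF assms])

lemma adjacency_matrix_mult:
  assumes fin: "finite (verts G)" and i: "i < card (verts G)"
    and v: "v \<in> carrier_vec (card (verts G))"
    and f: "\<And>j. j < card (verts G) \<Longrightarrow> v $ j = f (vertex_list G ! j)"
  shows "(adjacency_matrix G *\<^sub>v v) $ i = (\<Sum>x\<in>nbrs G (vertex_list G ! i). f x)"
proof -
  let ?vs = "vertex_list G" and ?n = "card (verts G)"
  have "(adjacency_matrix G *\<^sub>v v) $ i
      = (\<Sum>j<?n. (if {?vs ! i, ?vs ! j} \<in> edges G then 1 else 0) * f (?vs ! j))"
    using i v f
    by (simp add: length_vertex_list[OF fin] adjacency_matrix_def Let_def scalar_prod_def atLeast0LessThan)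
  also have "\<dots> = (\<Sum>x\<in>verts G. (if {?vs ! i, x} \<in> edges G then 1 else 0) * f x)"
    by (rule sum.reindex_bij_betw[OF bij_betw_vertex_list[OF fin]])
  also have "\<dots> = (\<Sum>x\<in>nbrs G (?vs ! i). f x)"
    unfolding nbrs_def by (rule sum.mono_neutral_cong_right) (use fin in auto)
  finally show ?thesis .
qed

text \<open>Together with its converse below, this trades vectors indexed by an arbitrary
  enumeration for functions on vertices, so that all later estimates concern neighbourhood
  sums.\<close>

lemma vertex_function_of_eigenvalue:
  assumes fin: "finite (verts G)" and "eigenvalue (adjacency_matrix G) k"
  obtains f where "\<exists>u\<in>verts G. f u \<noteq> 0"
    "\<And>u. u \<in> verts G \<Longrightarrow> (\<Sum>v\<in>nbrs G u. f v) = k * f u"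
proof -
  let ?vs = "vertex_list G" and ?n = "card (verts G)"
  have dim: "dim_row (adjacency_matrix G) = ?n"
    using adjacency_matrix_carrier[OF fin] by simp
  note bij = bij_betw_vertex_list[OF fin]
  obtain v where "eigenvector (adjacency_matrix G) v k"
    using assms(2) unfolding eigenvalue_def by (rule exE)
  then have v: "v \<in> carrier_vec ?n" "v \<noteq> 0\<^sub>v ?n"
      "adjacency_matrix G *\<^sub>v v = k \<cdot>\<^sub>v v"
    unfolding eigenvector_def dim by simp_all
  define f where "f x = v $ inv_into {..<?n} ((!) ?vs) x" for x
  have f: "v $ j = f (?vs ! j)" if "j < ?n" for j
    using that bij by (simp add: f_def bij_betw_def)
  have "\<exists>j<?n. v $ j \<noteq> 0"
  proof (rule ccontr)
    assume "\<not> ?thesis"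
    then have "v = 0\<^sub>v ?n" using v(1) by (intro eq_vecI) auto
    then show False using v(2) by simp
  qed
  then obtain j where j: "j < ?n" "v $ j \<noteq> 0" by blast
  have "?vs ! j \<in> verts G" using bij_betwE[OF bij] j(1) by simp
  then have "\<exists>u\<in>verts G. f u \<noteq> 0" using f[OF j(1)] j(2) by (intro bexI) simp_all
  moreover have "(\<Sum>x\<in>nbrs G u. f x) = k * f u" if u: "u \<in> verts G" for u
  proof -
    obtain i where i: "i < ?n" "u = ?vs ! i" using bij u by (auto simp: bij_betw_def)
    have "(adjacency_matrix G *\<^sub>v v) $ i = (\<Sum>x\<in>nbrs G u. f x)"
      unfolding i(2) by (rule adjacency_matrix_mult[OF fin i(1) v(1) f])
    then show ?thesis using v i f by simp
  qed
  ultimately show thesis by (rule that)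
qed

lemma eigenvalue_of_vertex_function:
  assumes fin: "finite (verts G)" and u: "u \<in> verts G" "f u \<noteq> 0"
    and f: "\<And>u. u \<in> verts G \<Longrightarrow> (\<Sum>v\<in>nbrs G u. f v) = k * f u"
  shows "eigenvalue (adjacency_matrix G) k"
proof -
  let ?vs = "vertex_list G" and ?n = "card (verts G)"
  have dim: "dim_row (adjacency_matrix G) = ?n"
    using adjacency_matrix_carrier[OF fin] by simp
  note bij = bij_betw_vertex_list[OF fin]
  define v where "v = vec ?n (\<lambda>j. f (?vs ! j))"
  have v: "v \<in> carrier_vec ?n" by (simp add: v_def)
  obtain j where j: "j < ?n" "u = ?vs ! j" using bij u by (auto simp: bij_betw_def)
  then have "v $ j \<noteq> 0" using u by (simp add: v_def)
  then have nz: "v \<noteq> 0\<^sub>v ?n" using j by auto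
  have "adjacency_matrix G *\<^sub>v v = k \<cdot>\<^sub>v v"
  proof (rule eq_vecI)
    fix i assume "i < dim_vec (k \<cdot>\<^sub>v v)"
    then have i: "i < ?n" by (simp add: v_def)
    have "?vs ! i \<in> verts G" using bij_betwE[OF bij] i by simp
    moreover have "(adjacency_matrix G *\<^sub>v v) $ i = (\<Sum>x\<in>nbrs G (?vs ! i). f x)"
      by (rule adjacency_matrix_mult[OF fin i v]) (simp add: v_def)
    ultimately show "(adjacency_matrix G *\<^sub>v v) $ i = (k \<cdot>\<^sub>v v) $ i"
      using i f by (simp add: v_def)
  qed (simp add: v_def dim)
  then have "eigenvector (adjacency_matrix G) v k"
    using v nz unfolding eigenvector_def dim by simp
  then show ?thesis unfolding eigenvalue_def by (rule exI)
qed

lemma norm_eigenvalue_le_spectral_radius: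
  assumes "finite (verts G)" "verts G \<noteq> {}" and "eigenvalue (adjacency_matrix G) k"
  shows "norm k \<le> graph_spectral_radius G"
proof -
  have "0 < card (verts G)" using assms(1,2) by (simp add: card_gt_0_iff)
  from spectral_radius_mem_max(2)[OF adjacency_matrix_carrier[OF assms(1)] this, of "norm k"]
  show ?thesis using assms(3) by (simp add: graph_spectral_radius_def spectrum_def)
qed

text \<open>A substitute for the Perron vector: taking moduli in the eigenvector equation costs only
  the triangle inequality, and the resulting inequality is all that the walk counts use.\<close>

lemma subinvariant_vector:
  assumes "finite (verts G)" "verts G \<noteq> {}"
  obtains y :: "'a \<Rightarrow> real" where "\<And>v. 0 \<le> y v" "\<exists>v\<in>verts G. 0 < y v"
    "\<And>u. u \<in> verts G \<Longrightarrow> graph_spectral_radius G * y u \<le> (\<Sum>v\<in>nbrs G u. y v)"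
proof -
  have "0 < card (verts G)" using assms by (simp add: card_gt_0_iff)
  from spectral_radius_mem_max(1)[OF adjacency_matrix_carrier[OF assms(1)] this]
  obtain k where k: "eigenvalue (adjacency_matrix G) k" "graph_spectral_radius G = norm k"
    by (auto simp: graph_spectral_radius_def spectrum_def)
  obtain f where f: "\<exists>u\<in>verts G. f u \<noteq> 0"
    "\<And>u. u \<in> verts G \<Longrightarrow> (\<Sum>v\<in>nbrs G u. f v) = k * f u"
    using vertex_function_of_eigenvalue[OF assms(1) k(1)] by blast
  show thesis
  proof (rule that[of "\<lambda>v. norm (f v)"])
    fix u assume "u \<in> verts G"
    then have "norm k * norm (f u) = norm (\<Sum>v\<in>nbrs G u. f v)"
      using f(2) by (simp add: norm_mult)
    also have "\<dots> \<le> (\<Sum>v\<in>nbrs G u. norm (f v))" by (rule norm_sum)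
    finally show "graph_spectral_radius G * norm (f u) \<le> (\<Sum>v\<in>nbrs G u. norm (f v))"
      using k(2) by simp
  qed (use f(1) in auto)
qed

text \<open>As an eigenvalue, \<open>t\<close> is at most the spectral radius. Conversely, a
  subinvariant \<open>y\<close> is paired with \<open>z\<close>: moving the adjacency matrix from
  \<open>y\<close> to \<open>z\<close> turns the factor \<open>?r\<close> into \<open>t\<close>, and
  the pairing is positive because \<open>z\<close> is.\<close>

lemma spectral_radius_eq_positive_eigenvector:
  fixes z :: "'a \<Rightarrow> real"
  assumes fin: "finite (verts G)" and ne: "verts G \<noteq> {}"
    and pos: "\<And>v. v \<in> verts G \<Longrightarrow> 0 < z v" and t: "0 \<le> t"
    and eig: "\<And>u. u \<in> verts G \<Longrightarrow> (\<Sum>v\<in>nbrs G u. z v) = t * z u"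
  shows "graph_spectral_radius G = t"
proof (rule antisym)
  obtain u0 where u0: "u0 \<in> verts G" using ne by blast
  have "eigenvalue (adjacency_matrix G) (complex_of_real t)"
  proof (rule eigenvalue_of_vertex_function[OF fin u0, of "\<lambda>v. complex_of_real (z v)"])
    show "complex_of_real (z u0) \<noteq> 0" using pos[OF u0] by simp
    fix u assume "u \<in> verts G"
    from eig[OF this]
    show "(\<Sum>v\<in>nbrs G u. complex_of_real (z v)) = complex_of_real t * complex_of_real (z u)"
      by (metis of_real_mult of_real_sum)
  qed
  from norm_eigenvalue_le_spectral_radius[OF fin ne this]
  show "t \<le> graph_spectral_radius G" using t by simp
  let ?r = "graph_spectral_radius G"
  obtain y :: "'a \<Rightarrow> real" where y: "\<And>v. 0 \<le> y v" "\<exists>v\<in>verts G. 0 < y v"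
    "\<And>u. u \<in> verts G \<Longrightarrow> ?r * y u \<le> (\<Sum>v\<in>nbrs G u. y v)"
    using subinvariant_vector[OF fin ne] by blast
  have "?r * (\<Sum>u\<in>verts G. y u * z u) = (\<Sum>u\<in>verts G. (?r * y u) * z u)"
    by (simp add: sum_distrib_left mult.assoc)
  also have "\<dots> \<le> (\<Sum>u\<in>verts G. (\<Sum>v\<in>nbrs G u. y v) * z u)"
    by (intro sum_mono mult_right_mono y(3) less_imp_le[OF pos])
  also have "\<dots> = (\<Sum>u\<in>verts G. \<Sum>v\<in>nbrs G u. y v * z u)"
    by (simp add: sum_distrib_right)
  also have "\<dots> = (\<Sum>v\<in>verts G. \<Sum>u\<in>nbrs G v. y v * z u)"
    by (rule sum_nbrs_swap[OF fin])
  also have "\<dots> = (\<Sum>v\<in>verts G. t * (y v * z v))"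
    using eig by (simp add: sum_distrib_left[symmetric] algebra_simps)
  also have "\<dots> = t * (\<Sum>v\<in>verts G. y v * z v)"
    by (simp add: sum_distrib_left)
  finally have "?r * (\<Sum>u\<in>verts G. y u * z u) \<le> t * (\<Sum>u\<in>verts G. y u * z u)" .
  moreover have "0 < (\<Sum>u\<in>verts G. y u * z u)"
  proof -
    obtain v where "v \<in> verts G" "0 < y v" using y(2) by blast
    then show ?thesis
      using fin y(1) less_imp_le[OF pos] pos by (intro sum_pos2[of _ v]) simp_all
  qed
  ultimately show "?r \<le> t" by simp
qed

section \<open>Invariance of the spectral radius under isomorphism\<close>

lemma graph_iso_sym:
  assumes "graph_iso G H" shows "graph_iso H G"
proof -
  obtain f where f: "bij_betw f (verts G) (verts H)"
    "\<And>u v. \<lbrakk>u \<in> verts G; v \<in> verts G\<rbrakk> \<Longrightarrow> {u, v} \<in> edges G \<longleftrightarrow> {f u, f v} \<in> edges H"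
    using assms unfolding graph_iso_def by blast
  let ?g = "inv_into (verts G) f"
  have "bij_betw ?g (verts H) (verts G)" by (rule bij_betw_inv_into[OF f(1)])
  moreover have "{u, v} \<in> edges H \<longleftrightarrow> {?g u, ?g v} \<in> edges G"
    if "u \<in> verts H" "v \<in> verts H" for u v
    using f(2)[of "?g u" "?g v"] that f(1) bij_betwE[OF bij_betw_inv_into[OF f(1)]]
    by (simp add: bij_betw_inv_into_right)
  ultimately show ?thesis unfolding graph_iso_def by blast
qed

text \<open>An eigenfunction on \<open>H\<close> composed with an isomorphism \<open>h\<close> is an
  eigenfunction on \<open>G\<close>, since \<open>h\<close> maps the neighbourhood of
  \<open>u\<close> bijectively onto that of \<open>h u\<close>.\<close>

lemma eigenvalue_graph_iso:
  assumes fin: "finite (verts G)" "finite (verts H)" and iso: "graph_iso G H"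
    and "eigenvalue (adjacency_matrix H) k"
  shows "eigenvalue (adjacency_matrix G) k"
proof -
  obtain h where h: "bij_betw h (verts G) (verts H)"
    "\<And>u v. \<lbrakk>u \<in> verts G; v \<in> verts G\<rbrakk> \<Longrightarrow> {u, v} \<in> edges G \<longleftrightarrow> {h u, h v} \<in> edges H"
    using iso unfolding graph_iso_def by blast
  obtain f where f: "\<exists>u\<in>verts H. f u \<noteq> 0"
    "\<And>u. u \<in> verts H \<Longrightarrow> (\<Sum>v\<in>nbrs H u. f v) = k * f u"
    using vertex_function_of_eigenvalue[OF fin(2) assms(4)] by blast
  have sum: "(\<Sum>v\<in>nbrs G u. f (h v)) = k * f (h u)" if u: "u \<in> verts G" for u
  proof -
    have "bij_betw h (nbrs G u) (nbrs H (h u))"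
      unfolding bij_betw_def
    proof
      show "inj_on h (nbrs G u)"
        using h(1) by (auto simp: bij_betw_def nbrs_def intro: inj_on_subset)
      show "h ` nbrs G u = nbrs H (h u)"
        using h(2)[OF u] h(1) by (fastforce simp: nbrs_def bij_betw_def)
    qed
    then have "(\<Sum>v\<in>nbrs G u. f (h v)) = (\<Sum>v\<in>nbrs H (h u). f v)"
      by (rule sum.reindex_bij_betw)
    then show ?thesis using f(2) bij_betwE[OF h(1)] u by simp
  qed
  obtain x where x: "x \<in> verts H" "f x \<noteq> 0" using f(1) by blast
  then have "x \<in> h ` verts G" using bij_betw_imp_surj_on[OF h(1)] by simp
  then obtain u where u: "u \<in> verts G" "x = h u" by (rule imageE)
  show ?thesis
  proof (rule eigenvalue_of_vertex_function[OF fin(1) u(1), of "\<lambda>u. f (h u)"])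
    show "f (h u) \<noteq> 0" using x(2) u(2) by simp
  qed (rule sum)
qed

lemma spectral_radius_graph_iso:
  assumes "finite (verts G)" "finite (verts H)" "graph_iso G H"
  shows "graph_spectral_radius G = graph_spectral_radius H"
proof -
  have "spectrum (adjacency_matrix G) = spectrum (adjacency_matrix H)"
    using eigenvalue_graph_iso[of G H] eigenvalue_graph_iso[of H G] graph_iso_sym assms
    by (auto simp: spectrum_def)
  then show ?thesis by (simp add: graph_spectral_radius_def spectral_radius_def)
qed

subsection \<open>Degrees and codegrees\<close>

text \<open>Think of \<open>X\<close> as a set of deleted vertices: \<open>X = {}\<close> yields the
  degree of \<open>z\<close> in \<open>G\<close>, and \<open>X = {u}\<close> its degree in
  \<open>G\<close> without \<open>u\<close>.\<close>

lemma bij_betw_nbrs_edges: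
  assumes G: "simple_graph G" and z: "z \<in> verts G" "z \<notin> X"
  shows "bij_betw (\<lambda>v. {z, v}) (nbrs G z - X) {e \<in> edges G. z \<in> e \<and> e \<inter> X = {}}"
  unfolding bij_betw_def
proof
  show "inj_on (\<lambda>v. {z, v}) (nbrs G z - X)"
    by (auto simp: inj_on_def doubleton_eq_iff)
  show "(\<lambda>v. {z, v}) ` (nbrs G z - X) = {e \<in> edges G. z \<in> e \<and> e \<inter> X = {}}" (is "?A = ?B")
  proof
    show "?A \<subseteq> ?B" using z by (auto simp: nbrs_def)
    show "?B \<subseteq> ?A"
    proof
      fix e assume e: "e \<in> ?B"
      then have "card e = 2" "e \<subseteq> verts G" using G by (auto simp: simple_graph_def)
      moreover from this e obtain v where "e = {z, v}"
        by (auto simp: card_2_iff insert_commute)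
      ultimately show "e \<in> ?A" using e by (auto simp: nbrs_def)
    qed
  qed
qed

lemma card_nbrs_add_card_edges:
  assumes G: "simple_graph G" and u: "u \<in> verts G"
  shows "card (nbrs G u) + card {e \<in> edges G. u \<notin> e} = card (edges G)"
proof -
  have "card (nbrs G u) = card {e \<in> edges G. u \<in> e}"
    using bij_betw_same_card[OF bij_betw_nbrs_edges[OF G u, of "{}"]] by simp
  moreover have "edges G = {e \<in> edges G. u \<in> e} \<union> {e \<in> edges G. u \<notin> e}" by blast
  ultimately show ?thesis
    using finite_edges[OF G] by (metis (no_types, lifting) card_Un_disjoint disjoint_iff
        finite_Un mem_Collect_eq)
qed

lemma card_nbrs_minus:
  assumes "simple_graph G" "z \<in> verts G" "z \<noteq> u"
  shows "card (nbrs G z - {u}) = card {e \<in> {e \<in> edges G. u \<notin> e}. z \<in> e}"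
proof -
  have "{e \<in> edges G. z \<in> e \<and> e \<inter> {u} = {}} = {e \<in> {e \<in> edges G. u \<notin> e}. z \<in> e}" by auto
  then show ?thesis
    using bij_betw_same_card[OF bij_betw_nbrs_edges[OF assms(1,2), of "{u}"]] assms(3) by simp
qed

lemma card_nbrs_minus_le:
  assumes "simple_graph G" "z \<in> verts G" "z \<noteq> u"
  shows "card (nbrs G z - {u}) \<le> card {e \<in> edges G. u \<notin> e}"
  unfolding card_nbrs_minus[OF assms]
  by (rule card_mono) (use finite_edges[OF assms(1)] in auto)

text \<open>Double counting in the graph with \<open>u\<close> deleted: an edge that avoids
  \<open>u\<close> has both ends among the remaining vertices.\<close>

lemma handshake_minus:
  assumes G: "simple_graph G"
  shows "(\<Sum>z\<in>verts G - {u}. card (nbrs G z - {u})) = 2 * card {e \<in> edges G. u \<notin> e}"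
proof -
  have "(\<Sum>z\<in>verts G - {u}. card (nbrs G z - {u}))
      = (\<Sum>z\<in>verts G - {u}. card {e \<in> {e \<in> edges G. u \<notin> e}. z \<in> e})"
    by (rule sum.cong) (use card_nbrs_minus[OF G] in auto)
  also have "\<dots> = 2 * card {e \<in> edges G. u \<notin> e}"
  proof (rule sum_multicount)
    show "finite (verts G - {u})" using G by (simp add: simple_graph_def)
    show "finite {e \<in> edges G. u \<notin> e}" using finite_edges[OF G] by simp
    show "\<forall>e\<in>{e \<in> edges G. u \<notin> e}. card {z \<in> verts G - {u}. z \<in> e} = 2"
    proof
      fix e assume e: "e \<in> {e \<in> edges G. u \<notin> e}"
      then have "{z \<in> verts G - {u}. z \<in> e} = e" using G by (auto simp: simple_graph_def)
      then show "card {z \<in> verts G - {u}. z \<in> e} = 2" using e G by (simp add: simple_graph_def)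
    qed
  qed
  finally show ?thesis .
qed

text \<open>Otherwise \<open>w\<close>, \<open>z\<close> and \<open>r + 1\<close> of their common
  neighbours carry a forbidden complete bipartite graph. Further edges among these vertices do no
  harm, as the subgraph need not be induced.\<close>

lemma codegree_le:
  assumes G: "simple_graph G" and free: "graph_free G (complete_bipartite 2 (r + 1))"
    and w: "w \<in> verts G" and z: "z \<in> verts G" and wz: "w \<noteq> z"
  shows "card (nbrs G w \<inter> nbrs G z) \<le> r"
proof (rule ccontr)
  assume "\<not> ?thesis"
  then obtain C where C: "C \<subseteq> nbrs G w \<inter> nbrs G z" "card C = r + 1" "finite C"
    by (metis not_less_eq_eq obtain_subset_with_card_n Suc_eq_plus1)
  have wzC: "w \<notin> C" "z \<notin> C" using C(1) nbrs_irrefl[OF G] by auto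
  define H where "H = SGraph ({w, z} \<union> C) {{x, y} | x y. x \<in> {w, z} \<and> y \<in> C}"
  have "subgraph H G"
    unfolding subgraph_def
  proof (intro conjI)
    show "verts H \<subseteq> verts G" using C w z by (auto simp: H_def nbrs_def)
    show "edges H \<subseteq> edges G" using C by (auto simp: H_def nbrs_def)
    show "simple_graph H"
      using C(3) wzC by (auto simp: simple_graph_def H_def card_insert_if)
  qed
  moreover have "graph_iso H (complete_bipartite 2 (r + 1))"
  proof -
    obtain g where g: "bij_betw g C {2..<2 + (r + 1)}"
      using finite_same_card_bij[of C "{2..<2 + (r + 1)}"] C by auto
    \<comment> \<open>The small side gets the labels 0 and 1, and \<open>C\<close> the labels 2 to
      \<open>r + 2\<close>, so \<open>f x < 2\<close> tells on which side \<open>x\<close>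
      lies.\<close>
    define f where "f x = (if x = w then 0 else if x = z then 1 else g x)" for x
    have gC: "2 \<le> g x" "g x < 2 + (r + 1)" if "x \<in> C" for x
      using bij_betwE[OF g] that by auto
    have fC: "f x = g x" if "x \<in> C" for x using that wzC by (auto simp: f_def)
    have "bij_betw f C {2..<2 + (r + 1)}"
      using g fC bij_betw_cong[of C f g] by blast
    moreover have "bij_betw f {w, z} {0..<2}"
      using wz by (auto simp: bij_betw_def f_def)
    ultimately have "bij_betw f ({w, z} \<union> C) ({0..<2} \<union> {2..<2 + (r + 1)})"
      by (intro bij_betw_combine) auto
    moreover have "{0..<2} \<union> {2..<2 + (r + 1)} = {0..<2 + (r + 1)}" by auto
    ultimately have "bij_betw f (verts H) (verts (complete_bipartite 2 (r + 1)))"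
      by (simp add: H_def complete_bipartite_def)
    moreover have "{x, y} \<in> edges H \<longleftrightarrow> {f x, f y} \<in> edges (complete_bipartite 2 (r + 1))"
      if "x \<in> verts H" "y \<in> verts H" for x y
    proof -
      have small: "f x < 2 \<longleftrightarrow> x \<in> {w, z}" if "x \<in> verts H" for x
        using that gC(1)[of x] fC[of x] wz wzC by (auto simp: H_def f_def)
      have big: "2 \<le> f x \<and> f x < 2 + (r + 1) \<longleftrightarrow> x \<in> C" if "x \<in> verts H" for x
        using that gC[of x] fC[of x] wz wzC by (auto simp: H_def f_def)
      have "{x, y} \<in> edges H \<longleftrightarrow> x \<in> {w, z} \<and> y \<in> C \<or> y \<in> {w, z} \<and> x \<in> C"
        by (auto simp: H_def doubleton_eq_iff)
      also have "\<dots> \<longleftrightarrow> f x < 2 \<and> (2 \<le> f y \<and> f y < 2 + (r + 1))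
          \<or> f y < 2 \<and> (2 \<le> f x \<and> f x < 2 + (r + 1))"
        using small[OF that(1)] small[OF that(2)] big[OF that(1)] big[OF that(2)] by blast
      also have "\<dots> \<longleftrightarrow> {f x, f y} \<in> edges (complete_bipartite 2 (r + 1))"
        by (auto simp: complete_bipartite_def doubleton_eq_iff)
      finally show ?thesis .
    qed
    ultimately show ?thesis unfolding graph_iso_def by blast
  qed
  ultimately show False using free unfolding graph_free_def by blast
qed

subsection \<open>Walk counting\<close>

text \<open>The normalised situation: \<open>c\<close> and \<open>c1\<close> together make 1,
  attained at \<open>u\<close>, the maximum of \<open>y\<close> on the vertices, and
  \<open>w\<close> attains the maximum \<open>c\<close> over the other vertices. The forbidden
  subgraph enters only through \<open>codeg\<close>.\<close>

locale subinvariant =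
  fixes G :: "'a sgraph" and r :: nat and \<rho> :: real and y :: "'a \<Rightarrow> real" and u w :: 'a and c :: real
  assumes G: "simple_graph G"
    and codeg: "\<And>w z. \<lbrakk>w \<in> verts G; z \<in> verts G; w \<noteq> z\<rbrakk> \<Longrightarrow> card (nbrs G w \<inter> nbrs G z) \<le> r"
    and rho: "0 \<le> \<rho>"
    and y0: "\<And>v. 0 \<le> y v"
    and sub: "\<And>v. v \<in> verts G \<Longrightarrow> \<rho> * y v \<le> (\<Sum>x\<in>nbrs G v. y x)"
    and u: "u \<in> verts G" "y u = 1"
    and w: "w \<in> verts G" "w \<noteq> u" "y w = c"
    and c: "\<And>v. v \<in> verts G - {u} \<Longrightarrow> y v \<le> c"
    and c1: "c \<le> 1"
begin

abbreviation "others \<equiv> {e \<in> edges G. u \<notin> e}"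

abbreviation "T \<equiv> (\<Sum>z\<in>verts G - {u}. y z)"

lemma fin: "finite (verts G)" using G by (simp add: simple_graph_def)

lemma c0: "0 \<le> c" using y0[of w] w by simp

text \<open>Subinvariance applied twice gives a sum over walks of length two from \<open>v\<close>.
  Grouped by their end \<open>z\<close>, there are as many as common neighbours of \<open>v\<close>
  and \<open>z\<close>: the degree if \<open>z = v\<close>, at most \<open>r\<close>
  otherwise.\<close>

lemma two_walks:
  assumes v: "v \<in> verts G"
  shows "\<rho>\<^sup>2 * y v \<le> card (nbrs G v) * y v + r * (\<Sum>z\<in>verts G - {v}. y z)"
proof -
  have "\<rho>\<^sup>2 * y v = \<rho> * (\<rho> * y v)" by (simp add: power2_eq_square)
  also have "\<dots> \<le> \<rho> * (\<Sum>x\<in>nbrs G v. y x)"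
    using sub[OF v] rho by (rule mult_left_mono)
  also have "\<dots> = (\<Sum>x\<in>nbrs G v. \<rho> * y x)" by (rule sum_distrib_left)
  also have "\<dots> \<le> (\<Sum>x\<in>nbrs G v. \<Sum>z\<in>nbrs G x. y z)"
    by (rule sum_mono, rule sub) (simp add: nbrs_def)
  also have "\<dots> = (\<Sum>x\<in>nbrs G v. \<Sum>z | z \<in> verts G \<and> {x, z} \<in> edges G. y z)"
    by (simp add: nbrs_def)
  also have "\<dots> = (\<Sum>z\<in>verts G. \<Sum>x | x \<in> nbrs G v \<and> {x, z} \<in> edges G. y z)"
    by (rule sum.swap_restrict) (use fin finite_nbrs[OF G] in auto)
  also have "\<dots> = (\<Sum>z\<in>verts G. card (nbrs G v \<inter> nbrs G z) * y z)"
  proof (rule sum.cong)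
    fix z
    have "{x. x \<in> nbrs G v \<and> {x, z} \<in> edges G} = nbrs G v \<inter> nbrs G z"
      by (auto simp: nbrs_def insert_commute)
    then show "(\<Sum>x | x \<in> nbrs G v \<and> {x, z} \<in> edges G. y z) = card (nbrs G v \<inter> nbrs G z) * y z"
      by simp
  qed simp
  also have "\<dots> = card (nbrs G v) * y v + (\<Sum>z\<in>verts G - {v}. card (nbrs G v \<inter> nbrs G z) * y z)"
    using sum.remove[OF fin v, of "\<lambda>z. card (nbrs G v \<inter> nbrs G z) * y z"] by simp
  also have "(\<Sum>z\<in>verts G - {v}. card (nbrs G v \<inter> nbrs G z) * y z) \<le> (\<Sum>z\<in>verts G - {v}. r * y z)"
    by (intro sum_mono mult_right_mono y0) (use codeg v in auto)
  finally show ?thesis by (simp add: sum_distrib_left)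
qed

lemma sum_nbrs_le:
  assumes z: "z \<in> verts G" "z \<noteq> u"
  shows "(\<Sum>x\<in>nbrs G z. y x) \<le> (if z \<in> nbrs G u then 1 else 0) + c * card (nbrs G z - {u})"
proof -
  have rest: "(\<Sum>x\<in>nbrs G z - {u}. y x) \<le> c * card (nbrs G z - {u})"
    using sum_bounded_above[of "nbrs G z - {u}" y c] c by (auto simp: nbrs_def mult.commute)
  show ?thesis
  proof (cases "u \<in> nbrs G z")
    case True
    then have "z \<in> nbrs G u" using z nbrs_sym[of z G u] by blast
    then show ?thesis
      using rest sum.remove[OF finite_nbrs[OF G] True, of y] u(2) by simp
  next
    case False
    then show ?thesis using rest by simp
  qed
qed

text \<open>Each neighbour of \<open>u\<close> sees \<open>u\<close> with entry 1 and its other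
  neighbours with entries at most \<open>c\<close>. Keeping the degrees of the neighbours of
  \<open>u\<close> exact is what later detects an extra edge with an end outside
  \<open>nbrs G u\<close>.\<close>

lemma square_le_degree:
  "\<rho>\<^sup>2 \<le> card (nbrs G u) + c * (\<Sum>v\<in>nbrs G u. card (nbrs G v - {u}))"
proof -
  have "\<rho>\<^sup>2 = \<rho> * (\<rho> * y u)" by (simp add: power2_eq_square u)
  also have "\<dots> \<le> \<rho> * (\<Sum>x\<in>nbrs G u. y x)"
    using sub[OF u(1)] rho by (rule mult_left_mono)
  also have "\<dots> = (\<Sum>x\<in>nbrs G u. \<rho> * y x)" by (rule sum_distrib_left)
  also have "\<dots> \<le> (\<Sum>x\<in>nbrs G u. 1 + c * card (nbrs G x - {u}))"
  proof (rule sum_mono)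
    fix x assume x: "x \<in> nbrs G u"
    then have "x \<in> verts G" "x \<noteq> u" using nbrs_irrefl[OF G] by (auto simp: nbrs_def)
    then show "\<rho> * y x \<le> 1 + c * card (nbrs G x - {u})"
      using sub[of x] sum_nbrs_le[of x] x by simp
  qed
  also have "\<dots> = card (nbrs G u) + c * (\<Sum>v\<in>nbrs G u. card (nbrs G v - {u}))"
    by (simp add: sum.distrib sum_distrib_left)
  finally show ?thesis .
qed

lemma square_le_size: "\<rho>\<^sup>2 \<le> card (nbrs G u) + 2 * card others * c"
proof -
  have "(\<Sum>v\<in>nbrs G u. card (nbrs G v - {u})) \<le> (\<Sum>v\<in>verts G - {u}. card (nbrs G v - {u}))"
    using fin nbrs_irrefl[OF G] by (intro sum_mono2) (auto simp: nbrs_def)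
  then have "real (\<Sum>v\<in>nbrs G u. card (nbrs G v - {u})) \<le> real (2 * card others)"
    unfolding handshake_minus[OF G] by (rule of_nat_mono)
  from mult_left_mono[OF this c0] show ?thesis
    using square_le_degree by (simp add: mult_ac)
qed

text \<open>Subinvariance is summed over all vertices other than \<open>u\<close>: the entry 1 of
  \<open>u\<close> is counted once per neighbour, and the degrees without \<open>u\<close> add up to
  twice the number of \<open>others\<close>.\<close>

lemma mult_total_le: "\<rho> * T \<le> card (nbrs G u) + 2 * card others * c"
proof -
  have "\<rho> * T = (\<Sum>z\<in>verts G - {u}. \<rho> * y z)" by (rule sum_distrib_left)
  also have "\<dots> \<le> (\<Sum>z\<in>verts G - {u}. (if z \<in> nbrs G u then 1 else 0) + c * card (nbrs G z - {u}))"
    by (rule sum_mono) (use sub sum_nbrs_le in \<open>fastforce intro: order_trans\<close>)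
  also have "\<dots> = (\<Sum>z\<in>verts G - {u}. if z \<in> nbrs G u then 1 else 0)
      + c * real (\<Sum>z\<in>verts G - {u}. card (nbrs G z - {u}))"
    by (simp add: sum.distrib sum_distrib_left)
  also have "(\<Sum>z\<in>verts G - {u}. if z \<in> nbrs G u then 1 else (0::real)) = card (nbrs G u)"
  proof -
    have "(verts G - {u}) \<inter> nbrs G u = nbrs G u"
      using nbrs_irrefl[OF G] by (auto simp: nbrs_def)
    then show ?thesis using fin by (simp add: sum.If_cases Int_def)
  qed
  finally show ?thesis unfolding handshake_minus[OF G] by (simp add: mult_ac)
qed

lemma square_le_total: "\<rho>\<^sup>2 \<le> card (nbrs G u) + r * T"
  using two_walks[OF u(1)] u(2) by simp

lemma card_nbrs_w: "card (nbrs G w) \<le> card others + 1"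
proof -
  have "card (nbrs G w) \<le> card (nbrs G w - {u}) + 1"
    using card_Diff1_le[of "nbrs G w" u] by (cases "u \<in> nbrs G w") (simp_all add: card_Diff_singleton)
  then show ?thesis using card_nbrs_minus_le[OF G w(1,2)] by simp
qed

lemma square_mult_le: "\<rho>\<^sup>2 * c \<le> (card others + 1) * c + r + r * T"
proof -
  \<comment> \<open>The entry of \<open>w\<close> is put back into the sum so that the bound is
    expressed by \<open>T\<close>.\<close>
  have "(\<Sum>z\<in>verts G - {w}. y z) \<le> (\<Sum>z\<in>verts G. y z)"
    using fin y0 by (intro sum_mono2) auto
  also have "\<dots> = 1 + T" using sum.remove[OF fin u(1), of y] u(2) by simp
  finally have "r * (\<Sum>z\<in>verts G - {w}. y z) \<le> r * (1 + T)" by (rule mult_left_mono) simp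
  moreover have "card (nbrs G w) * c \<le> (card others + 1) * c"
    by (rule mult_right_mono[OF _ c0]) (use card_nbrs_w in linarith)
  ultimately show ?thesis using two_walks[OF w(1)] w(3) by (simp add: algebra_simps)
qed

text \<open>Apart from \<open>u\<close>, the vertex \<open>w\<close> has at most one neighbour for
  each edge that avoids \<open>u\<close>.\<close>

lemma mult_le: "\<rho> * c \<le> 1 + card others * c"
proof -
  have "\<rho> * c \<le> 1 + c * card (nbrs G w - {u})"
    using sub[OF w(1)] sum_nbrs_le[OF w(1,2)] w(3) by (auto split: if_splits)
  also have "\<dots> \<le> 1 + c * card others"
    using card_nbrs_minus_le[OF G w(1,2)] c0 by (intro add_left_mono mult_left_mono) auto
  finally show ?thesis by (simp add: mult.commute)
qed

end

section \<open>Numerical elimination: at most one edge avoids the maximal vertex\<close>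

lemma few_other_edges:
  fixes \<rho> r d c T :: real and a :: nat
  assumes r: "2 \<le> r" and rho: "4 * r + 2 \<le> \<rho>" and c: "0 \<le> c" "c \<le> 1" and d: "0 \<le> d"
    and size: "d + a < \<rho>\<^sup>2 + 1"
    and h1: "\<rho>\<^sup>2 \<le> d + r * T"
    and h2: "\<rho> * T \<le> d + 2 * a * c"
    and h3: "\<rho>\<^sup>2 * c \<le> (a + 1) * c + r + r * T"
    and h4: "\<rho> * c \<le> 1 + a * c"
    and h5: "\<rho>\<^sup>2 \<le> d + 2 * a * c"
  shows "a \<le> 1"
proof -
  define R where "R = \<rho>\<^sup>2"
  have rho10: "10 \<le> \<rho>" using r rho by simp
  have R: "10 * \<rho> \<le> R"
    using mult_right_mono[OF rho10, of \<rho>] rho10 by (simp add: R_def power2_eq_square)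
  have ac: "0 \<le> a * c" "a * c \<le> a" using c by (simp_all add: mult_left_le)
  have rT: "r * (\<rho> * T) \<le> r * (d + 2 * a * c)" using h2 r by (intro mult_left_mono) auto
  \<comment> \<open>The hypothesis on \<rho> enters here, replacing the factor \<open>r\<close> by
    \<open>(\<rho> - 2) / 4\<close>.\<close>
  have r4: "4 * (r * x) \<le> (\<rho> - 2) * x" if "0 \<le> x" for x
    using mult_right_mono[OF _ that, of "4 * r" "\<rho> - 2"] rho by (simp add: mult.assoc)
  have a3: "3 * a + 1 \<le> R"
  proof (rule ccontr)
    assume "\<not> ?thesis"
    then have na: "R < 3 * a + 1" by simp
    have nonneg: "0 \<le> R + 1 + real a" using R rho10 by simp
    \<comment> \<open>Multiplying by \<rho> makes the bound on \<open>\<rho> * T\<close> applicable.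
      With \<open>c \<le> 1\<close> and \<open>R < 3 * a + 1\<close> everything collapses to
      \<open>8 * R < 18 * \<rho> - 4\<close>, against \<open>10 * \<rho> \<le> R\<close>.\<close>
    have "real a - 1 < r * T" using h1 size by simp
    then have "\<rho> * (real a - 1) < \<rho> * (r * T)" using rho10 by simp
    also have "\<dots> \<le> r * (d + 2 * a * c)" using rT by (simp add: mult_ac)
    also have "\<dots> \<le> r * (R + 1 + a)" using size ac r by (intro mult_left_mono) (auto simp: R_def)
    finally have "4 * (\<rho> * (real a - 1)) < (\<rho> - 2) * (R + 1 + a)"
      using r4[OF nonneg] by linarith
    then have "a * (3 * \<rho> + 2) < (\<rho> - 2) * (R + 1) + 4 * \<rho>" by (simp add: algebra_simps)
    moreover have "R * (3 * \<rho> + 2) < (3 * a + 1) * (3 * \<rho> + 2)"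
      using na rho10 by (intro mult_strict_right_mono) auto
    ultimately show False using R rho10 by (simp add: algebra_simps)
  qed
  have c3: "c \<le> 1 / 3"
  proof (rule ccontr)
    assume "\<not> ?thesis"
    then have nc: "1 / 3 < c" by simp
    \<comment> \<open>The coefficient of \<open>c\<close> once all terms containing \<open>c\<close>
      in the estimate below are on the left.\<close>
    define K where "K = 4 * \<rho> * (R - a - 1) - 2 * a * (\<rho> - 2)"
    have nonneg: "0 \<le> \<rho> + R + 1 - real a" using a3 rho10 by simp
    have "c * (R - a - 1) \<le> r + r * T" using h3 by (simp add: R_def algebra_simps)
    then have "\<rho> * (c * (R - a - 1)) \<le> \<rho> * (r + r * T)"
      using rho10 by (intro mult_left_mono) auto
    also have "\<dots> \<le> r * \<rho> + r * (d + 2 * a * c)" using rT by (simp add: algebra_simps)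
    also have "\<dots> \<le> r * (\<rho> + R + 1 - a) + r * (2 * a * c)"
      using mult_left_mono[of d "R + 1 - a" r] size r by (simp add: R_def algebra_simps)
    finally have "4 * (\<rho> * (c * (R - a - 1)))
        \<le> (\<rho> - 2) * (\<rho> + R + 1 - a) + (\<rho> - 2) * (2 * a * c)"
      using r4[OF nonneg] r4[of "2 * a * c"] ac by linarith
    then have le: "c * K \<le> (\<rho> - 2) * (\<rho> + R + 1 - a)" by (simp add: K_def algebra_simps)
    have "0 \<le> \<rho> * (R - 3 * a - 1)" using a3 rho10 by simp
    then have m: "3 * (a * \<rho>) + \<rho> \<le> \<rho> * R" by (simp add: algebra_simps)
    have Rr: "\<rho> * \<rho> = R" by (simp add: R_def power2_eq_square)
    have RR: "10 * R \<le> \<rho> * R" using rho10 R by (intro mult_right_mono) auto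
    have K_eq: "K = 4 * (\<rho> * R) - 6 * (a * \<rho>) - 4 * \<rho> + 4 * a"
      by (simp add: K_def algebra_simps)
    then have K: "0 < K" using m RR R rho10 by linarith
    have "K \<le> 3 * (c * K)" using mult_right_mono[of "1/3" c K] nc K by simp
    \<comment> \<open>By \<open>m\<close> the terms of third order in \<rho> cancel in favour of the
      left side, which leaves \<open>3 * R + 6 \<le> 2 * a\<close>, against
      \<open>a3\<close>.\<close>
    then have "K \<le> 3 * ((\<rho> - 2) * (\<rho> + R + 1 - a))" using le by simp
    also have "\<dots> = 3 * (\<rho> * \<rho>) + 3 * (\<rho> * R) - 3 * (a * \<rho>) - 3 * \<rho> - 6 * R - 6 + 6 * a"
      by (simp add: algebra_simps)
    finally show False using m a3 R rho10 unfolding K_eq Rr by linarith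
  qed
  \<comment> \<open>From here on \<open>h5\<close> and \<open>size\<close> are used in the form
    \<open>a - 1 < 2 * a * c\<close>: first with \<open>c \<le> 1 / 3\<close>, then with the bound
    \<open>1 / 8\<close> that \<open>h4\<close> yields for \<open>a \<le> 2\<close>.\<close>
  have "a * c \<le> a * (1 / 3)" using c3 by (intro mult_left_mono) auto
  then have "real a < 3" using h5 size by simp
  then have a2: "real a \<le> 2" by simp
  have "10 * c \<le> \<rho> * c" "a * c \<le> 2 * c" using rho10 a2 c by (auto intro: mult_right_mono)
  then have "c \<le> 1 / 8" using h4 by simp
  then have "a * c \<le> a * (1 / 8)" by (intro mult_left_mono) auto
  then have "real a < 2" using h5 size by simp
  then show ?thesis by simp
qed

subsection \<open>The star with one additional edge\<close>

text \<open>This form isolates the excess of \<open>x\<^sup>2\<close> over \<open>m - 1\<close>, the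
  quantity that the walk counts bound.\<close>

lemma star_plus_cubic_factor:
  "x ^ 3 - x ^ 2 - (real m - 1) * x + real m - 3 = (x - 1) * (x\<^sup>2 - (real m - 1)) - 2"
  by (simp add: algebra_simps power2_eq_square power3_eq_cube)

text \<open>With \<open>s = sqrt (m - 1)\<close>, the product is 0 at \<open>s\<close> and
  \<open>s * (2 * s + 1)\<close> at \<open>s + 1\<close>, so it takes the value 2 in between. Beyond
  \<open>s\<close> both factors are positive and increasing, so this root of the cubic is the
  largest.\<close>

lemma star_plus_cubic_root:
  assumes m: "3 \<le> m"
  obtains \<theta> :: real where "sqrt (real m - 1) < \<theta>"
    "(\<theta> - 1) * (\<theta>\<^sup>2 - (real m - 1)) = 2"
    "\<And>x. \<theta> < x \<Longrightarrow> 2 < (x - 1) * (x\<^sup>2 - (real m - 1))"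
proof -
  define s where "s = sqrt (real m - 1)"
  have s: "1 < s" "s\<^sup>2 = real m - 1" using m by (simp_all add: s_def)
  let ?q = "\<lambda>x. (x - 1) * (x\<^sup>2 - s\<^sup>2)"
  have "2 \<le> ?q (s + 1)" using s(1) by (simp add: power2_eq_square algebra_simps)
      (use mult_mono[of 1 s 1 s] in simp)
  moreover have "continuous_on {s..s + 1} ?q" by (intro continuous_intros)
  ultimately obtain \<theta> where t: "s \<le> \<theta>" "?q \<theta> = 2"
    using IVT'[of ?q s 2 "s + 1"] by auto
  have st: "s < \<theta>" using t by (cases "s = \<theta>") auto
  show thesis
  proof (rule that)
    show "sqrt (real m - 1) < \<theta>" using st by (simp add: s_def)
    show "(\<theta> - 1) * (\<theta>\<^sup>2 - (real m - 1)) = 2" using t s by simp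
    fix x assume x: "\<theta> < x"
    have "\<theta>\<^sup>2 < x\<^sup>2" using x st s by (intro power_strict_mono) auto
    moreover have "s\<^sup>2 < \<theta>\<^sup>2" using st s by (intro power_strict_mono) auto
    ultimately have "?q \<theta> < ?q x"
      using x st s by (intro mult_strict_mono) auto
    then show "2 < (x - 1) * (x\<^sup>2 - (real m - 1))" using t s by simp
  qed
qed

lemma verts_star: "1 \<le> n \<Longrightarrow> verts (star n) = {0..<n}"
  by (simp add: star_def complete_bipartite_def)

lemma edges_star_iff:
  "1 \<le> n \<Longrightarrow> {i, j} \<in> edges (star n) \<longleftrightarrow> i = 0 \<and> 1 \<le> j \<and> j < n \<or> j = 0 \<and> 1 \<le> i \<and> i < n"
  by (auto simp: star_def complete_bipartite_def doubleton_eq_iff)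

lemma verts_star_plus: "1 \<le> n \<Longrightarrow> verts (star_plus n k) = {0..<n}"
  by (simp add: star_plus_def verts_star)

lemma edges_star_plus_1_iff:
  "1 \<le> n \<Longrightarrow> {i, j} \<in> edges (star_plus n 1) \<longleftrightarrow>
    i = 0 \<and> 1 \<le> j \<and> j < n \<or> j = 0 \<and> 1 \<le> i \<and> i < n \<or> i = 1 \<and> j = 2 \<or> i = 2 \<and> j = 1"
proof -
  assume n: "1 \<le> n"
  have "{i, j} \<in> edges (star_plus n 1) \<longleftrightarrow> {i, j} \<in> edges (star n) \<or> {i, j} = {1, 2}"
    by (auto simp: star_plus_def numeral_2_eq_2)
  also have "{i, j} = {1, 2} \<longleftrightarrow> i = 1 \<and> j = 2 \<or> i = 2 \<and> j = 1"
    by (simp add: doubleton_eq_iff)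
  finally show ?thesis using edges_star_iff[OF n] by blast
qed

lemma spectral_radius_star_plus_1:
  assumes m: "3 \<le> m" and t: "1 < \<theta>" "(\<theta> - 1) * (\<theta>\<^sup>2 - (real m - 1)) = 2"
  shows "graph_spectral_radius (star_plus m 1) = \<theta>"
proof -
  let ?S = "star_plus m 1"
  \<comment> \<open>With entry 1 at the centre, the eigenvalue equations at the leaves force
    \<open>1 / (\<theta> - 1)\<close> on the two leaves of the triangle and
    \<open>1 / \<theta>\<close> on the pendant ones. The equation at the centre is then the
    cubic.\<close>
  define z :: "nat \<Rightarrow> real"
    where "z i = (if i = 0 then 1 else if i \<le> 2 then 1 / (\<theta> - 1) else 1 / \<theta>)" for i
  have V: "verts ?S = {0..<m}" using m by (simp add: verts_star_plus)
  have E: "nbrs ?S i = {j \<in> {0..<m}. i = 0 \<and> 1 \<le> j \<and> j < m \<or> j = 0 \<and> 1 \<le> i \<and> i < m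
      \<or> i = 1 \<and> j = 2 \<or> i = 2 \<and> j = 1}" for i
    unfolding nbrs_def V using m edges_star_plus_1_iff[of m i] by simp
  show ?thesis
  proof (rule spectral_radius_eq_positive_eigenvector)
    show "finite (verts ?S)" "verts ?S \<noteq> {}" "0 \<le> \<theta>" using V m t by auto
    show "0 < z v" for v using t by (simp add: z_def)
    fix i assume "i \<in> verts ?S"
    then have i: "i < m" using V by simp
    consider "i = 0" | "i = 1" | "i = 2" | "3 \<le> i" by linarith
    then show "(\<Sum>v\<in>nbrs ?S i. z v) = \<theta> * z i"
    proof cases
      case 1
      have "nbrs ?S i = insert 1 (insert 2 {3..<m})" unfolding E using 1 m by auto
      moreover have "(\<Sum>v\<in>{3..<m}. z v) = (\<Sum>v\<in>{3..<m}. 1 / \<theta>)"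
        by (rule sum.cong) (auto simp: z_def)
      ultimately have "(\<Sum>v\<in>nbrs ?S i. z v) = 2 / (\<theta> - 1) + (real m - 3) / \<theta>"
        using m by (simp add: z_def of_nat_diff)
      also have "2 / (\<theta> - 1) = \<theta>\<^sup>2 - (real m - 1)" using t by (simp add: field_simps)
      also have "\<dots> + (real m - 3) / \<theta> = \<theta>"
        using t by (simp add: divide_simps) (simp add: algebra_simps power2_eq_square)
      finally show ?thesis using 1 by (simp add: z_def)
    next
      case 2
      have "nbrs ?S i = {0, 2}" unfolding E using 2 m by auto
      then show ?thesis using 2 t by (simp add: z_def field_simps)
    next
      case 3
      have "nbrs ?S i = {0, 1}" unfolding E using 3 m by auto
      then show ?thesis using 3 t by (simp add: z_def field_simps)
    next
      case 4
      have "nbrs ?S i = {0}" unfolding E using 4 i by auto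
      then show ?thesis using 4 t by (simp add: z_def)
    qed
  qed
qed

subsection \<open>Graphs of large spectral radius\<close>

text \<open>This is where the absence of isolated vertices is used: a vertex lies on some edge,
  which either joins it to \<open>u\<close> or stays inside \<open>nbrs G u\<close>.\<close>

lemma verts_eq_insert_nbrs:
  assumes G: "simple_graph G" and iso: "no_isolated_vertices G" and u: "u \<in> verts G"
    and others: "\<And>e. \<lbrakk>e \<in> edges G; u \<notin> e\<rbrakk> \<Longrightarrow> e \<subseteq> nbrs G u"
  shows "verts G = insert u (nbrs G u)"
proof
  show "insert u (nbrs G u) \<subseteq> verts G" using u by (auto simp: nbrs_def)
  show "verts G \<subseteq> insert u (nbrs G u)"
  proof
    fix v assume v: "v \<in> verts G"
    then obtain e where e: "e \<in> edges G" "v \<in> e"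
      using iso by (auto simp: no_isolated_vertices_def)
    show "v \<in> insert u (nbrs G u)"
    proof (cases "u \<in> e \<and> v \<noteq> u")
      case True
      then have "e = {u, v}" using e G by (auto simp: simple_graph_def card_2_iff)
      then show ?thesis using e v by (simp add: nbrs_def)
    next
      case False
      then show ?thesis using others e by blast
    qed
  qed
qed

lemma graph_iso_star:
  assumes G: "simple_graph G" and iso: "no_isolated_vertices G" and u: "u \<in> verts G"
    and no: "{e \<in> edges G. u \<notin> e} = {}" and card: "card (nbrs G u) = m"
  shows "graph_iso G (star (m + 1))"
proof -
  have V: "verts G = insert u (nbrs G u)"
    by (rule verts_eq_insert_nbrs[OF G iso u]) (use no in blast)
  have un: "u \<notin> nbrs G u" by (rule nbrs_irrefl[OF G])
  obtain g where g: "bij_betw g (nbrs G u) {1..<m + 1}"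
    using finite_same_card_bij[of "nbrs G u" "{1..<m + 1}"] finite_nbrs[OF G] card by auto
  define f where "f x = (if x = u then 0 else g x)" for x
  have fN: "1 \<le> f x" "f x < m + 1" if "x \<in> nbrs G u" for x
    using bij_betwE[OF g] that un by (auto simp: f_def)
  have "bij_betw f (nbrs G u) {1..<m + 1}"
    using g un bij_betw_cong[of "nbrs G u" f g] by (metis f_def)
  moreover have "bij_betw f {u} {0}" by (simp add: f_def)
  ultimately have "bij_betw f ({u} \<union> nbrs G u) ({0} \<union> {1..<m + 1})"
    by (intro bij_betw_combine) auto
  moreover have "{0} \<union> {1..<m + 1} = {0..<m + 1}" by auto
  ultimately have "bij_betw f (verts G) (verts (star (m + 1)))"
    by (simp add: V verts_star)
  moreover have "{x, y} \<in> edges G \<longleftrightarrow> {f x, f y} \<in> edges (star (m + 1))"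
    if xy: "x \<in> verts G" "y \<in> verts G" for x y
  proof -
    have f0: "f v = 0 \<longleftrightarrow> v = u" if "v \<in> verts G" for v
      using that fN(1)[of v] by (auto simp: V f_def)
    have f1: "1 \<le> f v \<and> f v < m + 1 \<longleftrightarrow> v \<in> nbrs G u" if "v \<in> verts G" for v
      using that fN[of v] un by (auto simp: V f_def)
    have "{x, y} \<in> edges G \<longleftrightarrow> x = u \<and> y \<in> nbrs G u \<or> y = u \<and> x \<in> nbrs G u"
      using no xy by (auto simp: nbrs_def insert_commute)
    then show ?thesis
      using edges_star_iff[of "m + 1" "f x" "f y"] f0[OF xy(1)] f0[OF xy(2)]
        f1[OF xy(1)] f1[OF xy(2)] by simp
  qed
  ultimately show ?thesis unfolding graph_iso_def by blast
qed

lemma graph_iso_star_plus_1: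
  assumes G: "simple_graph G" and iso: "no_isolated_vertices G" and u: "u \<in> verts G"
    and one: "{e \<in> edges G. u \<notin> e} = {e}" and sub: "e \<subseteq> nbrs G u"
    and card: "card (nbrs G u) + 1 = m"
  shows "graph_iso G (star_plus m 1)"
proof -
  have V: "verts G = insert u (nbrs G u)"
    by (rule verts_eq_insert_nbrs[OF G iso u]) (use one sub in blast)
  have un: "u \<notin> nbrs G u" by (rule nbrs_irrefl[OF G])
  have "card e = 2" using one G by (auto simp: simple_graph_def)
  then obtain p q where e: "e = {p, q}" and pq: "p \<noteq> q" by (auto simp: card_2_iff)
  have pqN: "p \<in> nbrs G u" "q \<in> nbrs G u" using sub e by auto
  have cN: "card (nbrs G u - {p, q}) = card {3..<m}"
    using card pqN pq finite_nbrs[OF G] by (simp add: card_Diff_subset)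
  obtain g where g: "bij_betw g (nbrs G u - {p, q}) {3..<m}"
    using finite_same_card_bij[OF _ _ cN] finite_nbrs[OF G] by auto
  have m: "3 \<le> m"
    using card card_mono[of "nbrs G u" "{p, q}"] pqN pq finite_nbrs[OF G] by simp
  \<comment> \<open>The centre goes to 0 and the ends of the extra edge to 1 and 2, the pair that
    \<open>star_plus m 1\<close> joins; the other \<open>m - 3\<close> neighbours fill the remaining
    labels.\<close>
  define f where "f x = (if x = u then 0 else if x = p then 1 else if x = q then 2 else g x)" for x
  have npq: "p \<noteq> u" "q \<noteq> u" using pqN un by auto
  have fN: "3 \<le> f x" "f x < m" if "x \<in> nbrs G u - {p, q}" for x
    using bij_betwE[OF g] that un by (auto simp: f_def)
  have "f x = g x" if "x \<in> nbrs G u - {p, q}" for x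
    using that un by (auto simp: f_def)
  then have "bij_betw f (nbrs G u - {p, q}) {3..<m}"
    using g bij_betw_cong[of "nbrs G u - {p, q}" f g] by blast
  moreover have "bij_betw f {u, p, q} {0, 1, 2}"
    using npq pq by (auto simp: bij_betw_def f_def)
  ultimately have "bij_betw f ({u, p, q} \<union> (nbrs G u - {p, q})) ({0, 1, 2} \<union> {3..<m})"
    by (intro bij_betw_combine) auto
  moreover have "{0, 1, 2} \<union> {3..<m} = {0..<m}" using m by auto
  moreover have "{u, p, q} \<union> (nbrs G u - {p, q}) = verts G" using V pqN by auto
  ultimately have "bij_betw f (verts G) (verts (star_plus m 1))"
    using m by (simp add: verts_star_plus)
  moreover have "{x, y} \<in> edges G \<longleftrightarrow> {f x, f y} \<in> edges (star_plus m 1)"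
    if xy: "x \<in> verts G" "y \<in> verts G" for x y
  proof -
    have f0: "f v = 0 \<longleftrightarrow> v = u" if "v \<in> verts G" for v
      using that fN(1)[of v] npq by (auto simp: V f_def)
    have f1: "1 \<le> f v \<and> f v < m \<longleftrightarrow> v \<in> nbrs G u" if "v \<in> verts G" for v
      using that fN[of v] un m pqN npq by (auto simp: V f_def)
    have fp: "f v = 1 \<longleftrightarrow> v = p" if "v \<in> verts G" for v
      using that fN(1)[of v] npq by (auto simp: V f_def)
    have fq: "f v = 2 \<longleftrightarrow> v = q" if "v \<in> verts G" for v
      using that fN(1)[of v] npq pq by (auto simp: V f_def)
    have "{x, y} \<in> edges G \<longleftrightarrow> x = u \<and> y \<in> nbrs G u \<or> y = u \<and> x \<in> nbrs G u \<or> {x, y} = {p, q}"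
    proof (cases "u \<in> {x, y}")
      case True
      then show ?thesis using xy npq by (auto simp: nbrs_def insert_commute)
    next
      case False
      then have "{x, y} \<in> edges G \<longleftrightarrow> {x, y} \<in> {e \<in> edges G. u \<notin> e}" by simp
      then show ?thesis using False unfolding one e by auto
    qed
    also have "{x, y} = {p, q} \<longleftrightarrow> x = p \<and> y = q \<or> x = q \<and> y = p"
      by (simp add: doubleton_eq_iff)
    finally show ?thesis
      using edges_star_plus_1_iff[of m "f x" "f y"] m f0[OF xy(1)] f0[OF xy(2)]
        f1[OF xy(1)] f1[OF xy(2)] fp[OF xy(1)] fp[OF xy(2)] fq[OF xy(1)] fq[OF xy(2)] by simp
  qed
  ultimately show ?thesis unfolding graph_iso_def by blast
qed

text \<open>\<open>few_other_edges\<close> leaves at most one edge off \<open>u\<close>. If there is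
  one, it must join two neighbours of \<open>u\<close>, since otherwise the cubic expression would
  be at most 1.\<close>

lemma (in subinvariant) graph_iso_star_or_star_plus_1:
  assumes iso: "no_isolated_vertices G" and size: "card (edges G) = m"
    and r: "2 \<le> r" and rho4: "4 * real r + 2 \<le> \<rho>" and rho_m: "real m - 1 < \<rho>\<^sup>2"
    and cubic: "2 \<le> (\<rho> - 1) * (\<rho>\<^sup>2 - (real m - 1))"
  shows "graph_iso G (star (m + 1)) \<or> graph_iso G (star_plus m 1)"
proof -
  have m: "card (nbrs G u) + card others = m"
    using card_nbrs_add_card_edges[OF G u(1)] size by simp
  have "card others \<le> 1"
    by (rule few_other_edges[of "real r" \<rho> c "card (nbrs G u)" "card others" T])
      (use r rho4 c0 c1 m rho_m square_le_total mult_total_le square_mult_le mult_le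
        square_le_size in auto)
  then consider "card others = 0" | "card others = 1" by linarith
  then show ?thesis
  proof cases
    case 1
    then have "others = {}" using finite_edges[OF G] by simp
    then show ?thesis using graph_iso_star[OF G iso u(1)] m 1 by simp
  next
    case 2
    then obtain e where e: "others = {e}" by (auto simp: card_1_singleton_iff)
    have "e \<subseteq> nbrs G u"
    proof (rule ccontr)
      assume no: "\<not> ?thesis"
      have card_e: "card e = 2" using e G by (auto simp: simple_graph_def)
      have "(\<Sum>v\<in>nbrs G u. card (nbrs G v - {u})) = (\<Sum>v\<in>nbrs G u. if v \<in> e then 1 else 0)"
      proof (rule sum.cong)
        fix v assume "v \<in> nbrs G u"
        then have "v \<in> verts G" "v \<noteq> u" using nbrs_irrefl[OF G] by (auto simp: nbrs_def)
        from card_nbrs_minus[OF G this]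
        have "card (nbrs G v - {u}) = card {e' \<in> {e}. v \<in> e'}" unfolding e .
        also have "{e' \<in> {e}. v \<in> e'} = (if v \<in> e then {e} else {})" by auto
        finally show "card (nbrs G v - {u}) = (if v \<in> e then 1 else 0)" by simp
      qed simp
      also have "\<dots> = card (nbrs G u \<inter> e)"
        using finite_nbrs[OF G] by (simp add: sum.If_cases Int_def)
      also have "\<dots> < card e"
        using no card_e by (intro psubset_card_mono) (auto intro: card_ge_0_finite)
      finally have "(\<Sum>v\<in>nbrs G u. card (nbrs G v - {u})) \<le> 1" using card_e by simp
      then have "c * (\<Sum>v\<in>nbrs G u. card (nbrs G v - {u})) \<le> c"
        using c0 by (intro mult_left_le) linarith+
      \<comment> \<open>Here \<open>u\<close> has degree \<open>m - 1\<close>. For a single edge off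
        \<open>u\<close>, \<open>mult_le\<close> reads \<open>(\<rho> - 1) * c \<le> 1\<close>,
        which contradicts \<open>cubic\<close>.\<close>
      then have "\<rho>\<^sup>2 - (real m - 1) \<le> c" using square_le_degree m 2 by linarith
      then have "(\<rho> - 1) * (\<rho>\<^sup>2 - (real m - 1)) \<le> (\<rho> - 1) * c"
        using rho4 by (intro mult_left_mono) auto
      then show False using cubic mult_le 2 by (simp add: algebra_simps)
    qed
    then show ?thesis using graph_iso_star_plus_1[OF G iso u(1) e] m 2 by simp
  qed
qed

lemma graph_iso_star_or_star_plus_1:
  fixes G :: "'a sgraph"
  assumes G: "simple_graph G" and iso: "no_isolated_vertices G" and size: "card (edges G) = m"
    and free: "graph_free G (complete_bipartite 2 (r + 1))"
    and r: "2 \<le> r" and m: "0 < m" and rho4: "4 * real r + 2 \<le> graph_spectral_radius G"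
    and rho_m: "real m - 1 < (graph_spectral_radius G)\<^sup>2"
    and cubic: "2 \<le> (graph_spectral_radius G - 1) * ((graph_spectral_radius G)\<^sup>2 - (real m - 1))"
  shows "graph_iso G (star (m + 1)) \<or> graph_iso G (star_plus m 1)"
proof -
  let ?\<rho> = "graph_spectral_radius G"
  have fin: "finite (verts G)" using G by (simp add: simple_graph_def)
  obtain e where "e \<in> edges G" using size m by fastforce
  then have e: "e \<subseteq> verts G" "card e = 2" using G by (auto simp: simple_graph_def)
  then have ne: "verts G \<noteq> {}" by auto
  obtain x :: "'a \<Rightarrow> real" where x: "\<And>v. 0 \<le> x v" "\<exists>v\<in>verts G. 0 < x v"
    "\<And>u. u \<in> verts G \<Longrightarrow> ?\<rho> * x u \<le> (\<Sum>v\<in>nbrs G u. x v)"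
    using subinvariant_vector[OF fin ne] by blast
  obtain u where u: "u \<in> verts G" "Max (x ` verts G) = x u"
    using Max_in[of "x ` verts G"] fin ne by fastforce
  have xu: "x v \<le> x u" if "v \<in> verts G" for v
    using Max_ge[of "x ` verts G" "x v"] that fin u(2) by simp
  have xu0: "0 < x u" using x(2) xu by fastforce
  define y where "y v = x v / x u" for v
  \<comment> \<open>An edge supplies a second vertex, so the second largest entry exists.\<close>
  have "verts G - {u} \<noteq> {}"
  proof
    assume "verts G - {u} = {}"
    then have "e \<subseteq> {u}" using e by blast
    from card_mono[OF _ this] show False using e by simp
  qed
  then obtain w where w: "w \<in> verts G - {u}" "Max (y ` (verts G - {u})) = y w"
    using Max_in[of "y ` (verts G - {u})"] fin by fastforce
  interpret subinvariant G r ?\<rho> y u w "y w"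
  proof
    show "simple_graph G" by fact
    show "\<And>w z. \<lbrakk>w \<in> verts G; z \<in> verts G; w \<noteq> z\<rbrakk> \<Longrightarrow> card (nbrs G w \<inter> nbrs G z) \<le> r"
      by (rule codegree_le[OF G free])
    show "0 \<le> ?\<rho>" using rho4 by simp
    show "0 \<le> y v" for v using x(1) by (simp add: y_def)
    show "?\<rho> * y v \<le> (\<Sum>z\<in>nbrs G v. y z)" if "v \<in> verts G" for v
      using divide_right_mono[OF x(3)[OF that], of "x u"] xu0
      by (simp add: y_def sum_divide_distrib)
    show "u \<in> verts G" "y u = 1" using u xu0 by (simp_all add: y_def)
    show "w \<in> verts G" "w \<noteq> u" "y w = y w" using w by auto
    show "y v \<le> y w" if "v \<in> verts G - {u}" for v
      using Max_ge[of "y ` (verts G - {u})" "y v"] that fin w(2) by simp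
    show "y w \<le> 1" using xu[of w] w xu0 by (simp add: y_def)
  qed
  show ?thesis
    by (rule graph_iso_star_or_star_plus_1[OF iso size r rho4 rho_m cubic])
qed

theorem theorem1p3:
  fixes r m :: nat and G :: "'a sgraph"
  assumes "r \<ge> 2"
    and "m \<ge> (4 * r + 2) ^ 2 + 1"
    and "G \<in> free_graphs m (complete_bipartite 2 (r + 1))"
    and "\<not> graph_iso G (star (m + 1))"
  shows "(let \<rho> = graph_spectral_radius (star_plus m 1);
              p = (\<lambda>x :: real. x ^ 3 - x ^ 2 - (real m - 1) * x + real m - 3)
          in p \<rho> = 0 \<and> (\<forall>x. p x = 0 \<longrightarrow> x \<le> \<rho>))
       \<and> graph_spectral_radius G \<le> graph_spectral_radius (star_plus m 1)
       \<and> (graph_spectral_radius G = graph_spectral_radius (star_plus m 1)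
            \<longleftrightarrow> graph_iso G (star_plus m 1))"
proof -
  let ?\<rho> = "graph_spectral_radius G"
  have G: "simple_graph G" "no_isolated_vertices G" "card (edges G) = m"
    "graph_free G (complete_bipartite 2 (r + 1))"
    using assms(3) by (auto simp: free_graphs_def graph_size_def)
  have "(4 * 2 + 2)\<^sup>2 \<le> (4 * r + 2)\<^sup>2" using assms(1) by (intro power_mono) auto
  then have m: "3 \<le> m" using assms(2) by simp
  obtain \<theta> where t: "sqrt (real m - 1) < \<theta>" "(\<theta> - 1) * (\<theta>\<^sup>2 - (real m - 1)) = 2"
    "\<And>x. \<theta> < x \<Longrightarrow> 2 < (x - 1) * (x\<^sup>2 - (real m - 1))"
    using star_plus_cubic_root[OF m] by blast
  \<comment> \<open>The lower bound on \<open>m\<close> says exactly that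
    \<open>sqrt (m - 1)\<close>, and hence every \<rho> from \<theta> on, is at least
    \<open>4 * r + 2\<close>.\<close>
  have "real ((4 * r + 2)\<^sup>2) \<le> real (m - 1)" using assms(2) by (intro of_nat_mono) simp
  then have "(4 * real r + 2)\<^sup>2 \<le> real m - 1" using m by (simp add: of_nat_diff add.commute)
  then have r_le: "4 * real r + 2 \<le> sqrt (real m - 1)" by (rule real_le_rsqrt)
  then have t1: "1 < \<theta>" using t(1) by simp
  have theta: "graph_spectral_radius (star_plus m 1) = \<theta>"
    by (rule spectral_radius_star_plus_1[OF m t1 t(2)])
  \<comment> \<open>This implication suffices: together with \<open>eq\<close> it excludes a
    spectral radius above \<theta> and settles the case of equality.\<close>
  have iso: "graph_iso G (star_plus m 1)" if ge: "\<theta> \<le> ?\<rho>"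
  proof -
    have "(sqrt (real m - 1))\<^sup>2 < ?\<rho>\<^sup>2"
      using ge t(1) m by (intro power_strict_mono) auto
    then have "real m - 1 < ?\<rho>\<^sup>2" using m by simp
    moreover have "2 \<le> (?\<rho> - 1) * (?\<rho>\<^sup>2 - (real m - 1))"
      using ge t(2) t(3)[of ?\<rho>] by (cases "?\<rho> = \<theta>") auto
    ultimately have "graph_iso G (star (m + 1)) \<or> graph_iso G (star_plus m 1)"
      using r_le ge t(1) m assms(1) by (intro graph_iso_star_or_star_plus_1[OF G]) auto
    then show ?thesis using assms(4) by blast
  qed
  have eq: "?\<rho> = \<theta>" if "graph_iso G (star_plus m 1)"
    using spectral_radius_graph_iso[OF _ _ that] G(1) m theta
    by (simp add: simple_graph_def verts_star_plus)
  have "x \<le> \<theta>" if "(x - 1) * (x\<^sup>2 - (real m - 1)) - 2 = 0" for x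
    using t(3)[of x] that by linarith
  then show ?thesis
    unfolding Let_def theta star_plus_cubic_factor using t(2) iso eq by force
qed

end
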